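(* Suppose that $c_1=c_2=c_3=c$ with $c>0$, and let $k>0$. (i) For the $T_{ANB}$ model with $l\in[0,1]$, the equilibrium $E_2$ is locally stable if and only if $$ck<\frac{192-102\,l}{68-33\,l}.$$ (ii) For the $T_{LNB}$ model, the equilibrium $E_2$ is locally stable if and only if $$ck<\frac{62}{23}.$$
   Context: Both models are 3-dimensional discrete dynamical systems with parameters $c_1,c_2,c_3>0$, $k>0$ (and a proportion parameter $l\in[0,1]$ for $T_{ANB}$). They share the update rules $$y(t+1)=\sqrt{\tfrac{x(t)+z(t)}{c_2}}-x(t)-z(t),\qquad z(t+1)=z(t)+kz(t)\left[\tfrac{x(t)+y(t)}{(x(t)+y(t)+z(t))^2}-c_3\right].$$ In the $T_{ANB}$ model, $$x(t+1)=(1-l)x(t)+l\left[\sqrt{\tfrac{y(t)+z(t)}{c_1}}-y(t)-z(t)\right];$$ in the $T_{LNB}$ model, $$x(t+1)=\tfrac12\left[2x(t)+y(t)+z(t)-c_1\big(x(t)+y(t)+z(t)\big)^2\right].$$ For both, the equilibrium $E_2$ is $$E_2=\left(\frac{2(c_2+c_3-c_1)}{(c_1+c_2+c_3)^2},\frac{2(c_1+c_3-c_2)}{(c_1+c_2+c_3)^2},\frac{2(c_1+c_2-c_3)}{(c_1+c_2+c_3)^2}\right).$$ Local stability of an equilibrium is determined by the criterion that all eigenvalues of the Jacobian matrix of the iteration map at that equilibrium lie in the open unit disk $|\lambda|<1$ (equivalently, the strict Schur-Cohn inequalities hold for the characteristic polynomial).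
   Formalization: In part (i) the case l = 0 is excluded: there x(t+1) = x(t), so 1 is always an eigenvalue of the Jacobian and E_2 is never locally stable in the strict sense, although the inequality holds e.g. for c = k = 1. *)

theory Defs
  imports "HOL-Analysis.Analysis"
begin

(* States are vectors (x, y, z) = (s $ 1, s $ 2, s $ 3). *)

definition T_ANB :: "real \<Rightarrow> real \<Rightarrow> real \<Rightarrow> real \<Rightarrow> real \<Rightarrow> real^3 \<Rightarrow> real^3" where
  "T_ANB c1 c2 c3 k l s =
    (let x = s $ 1; y = s $ 2; z = s $ 3 in
     vector
      [(1 - l) * x + l * (sqrt ((y + z) / c1) - y - z),
       sqrt ((x + z) / c2) - x - z,
       z + k * z * ((x + y) / (x + y + z)\<^sup>2 - c3)])"

definition T_LNB :: "real \<Rightarrow> real \<Rightarrow> real \<Rightarrow> real \<Rightarrow> real^3 \<Rightarrow> real^3" where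
  "T_LNB c1 c2 c3 k s =
    (let x = s $ 1; y = s $ 2; z = s $ 3 in
     vector
      [(1/2) * (2 * x + y + z - c1 * (x + y + z)\<^sup>2),
       sqrt ((x + z) / c2) - x - z,
       z + k * z * ((x + y) / (x + y + z)\<^sup>2 - c3)])"

definition E2 :: "real \<Rightarrow> real \<Rightarrow> real \<Rightarrow> real^3" where
  "E2 c1 c2 c3 =
    vector
      [2 * (c2 + c3 - c1) / (c1 + c2 + c3)\<^sup>2,
       2 * (c1 + c3 - c2) / (c1 + c2 + c3)\<^sup>2,
       2 * (c1 + c2 - c3) / (c1 + c2 + c3)\<^sup>2]"

(* Eigenvalues of a real matrix are taken over the complex numbers. *)

definition complex_eigenvalue :: "real^'n^'n \<Rightarrow> complex \<Rightarrow> bool" where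
  "complex_eigenvalue A z \<longleftrightarrow>
    (\<exists>v :: complex^'n. v \<noteq> 0 \<and> map_matrix complex_of_real A *v v = z *s v)"

(* Local stability in the sense of the linearisation criterion. Differentiability is required
   because the jacobian of a map that is not differentiable at p is an arbitrary matrix. *)

definition locally_stable :: "(real^'n \<Rightarrow> real^'n) \<Rightarrow> real^'n \<Rightarrow> bool" where
  "locally_stable f p \<longleftrightarrow>
    f p = p \<and> f differentiable (at p) \<and>
    (\<forall>z. complex_eigenvalue (jacobian f (at p)) z \<longrightarrow> cmod z < 1)"

(* For l = 0 the first coordinate is never updated, so 1 is always an eigenvalue and the
   criterion fails at every point, whatever the parameters. *)

lemma T_ANB_0_not_locally_stable: "\<not> locally_stable (T_ANB c1 c2 c3 k 0) p"
proof
  define f where "f = T_ANB c1 c2 c3 k 0"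
  define J where "J = jacobian f (at p)"
  assume "locally_stable (T_ANB c1 c2 c3 k 0) p"
  then have diff: "f differentiable (at p)"
    and ev: "\<And>z. complex_eigenvalue J z \<Longrightarrow> cmod z < 1"
    by (auto simp: locally_stable_def f_def J_def)
  have "(f has_derivative (\<lambda>h. J *v h)) (at p)"
    using diff unfolding J_def by (simp add: jacobian_works)
  from bounded_linear.has_derivative[OF bounded_linear_vec_nth this]
  have d1: "((\<lambda>s. f s $ 1) has_derivative (\<lambda>h. (J *v h) $ 1)) (at p)" .
  have "(\<lambda>s. f s $ 1) = (\<lambda>s. s $ 1)"
    by (simp add: f_def T_ANB_def Let_def fun_eq_iff)
  with d1 have "((\<lambda>s. s $ 1) has_derivative (\<lambda>h. (J *v h) $ 1)) (at p)"
    by simp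
  moreover have "((\<lambda>s :: real^3. s $ 1) has_derivative (\<lambda>h. h $ 1)) (at p)"
    by (rule bounded_linear_imp_has_derivative) (rule bounded_linear_vec_nth)
  ultimately have "(\<lambda>h. (J *v h) $ 1) = (\<lambda>h. h $ 1)"
    by (rule has_derivative_unique)
  then have row0: "((J - mat 1) *v h) $ 1 = 0" for h
    by (simp add: matrix_vector_mult_diff_rdistrib fun_eq_iff)
  have "\<not> surj ((*v) (J - mat 1))"
  proof
    assume "surj ((*v) (J - mat 1))"
    then obtain h where "axis 1 1 = (J - mat 1) *v h"
      by (metis surjD)
    with row0[of h] show False
      by (metis axis_nth zero_neq_one)
  qed
  then have "\<not> (\<exists>B. B ** (J - mat 1) = mat 1)"
    using matrix_right_invertible_surjective matrix_left_right_inverse by blast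
  then obtain v :: "real^3" where v: "v \<noteq> 0" "(J - mat 1) *v v = 0"
    unfolding matrix_left_invertible_ker by blast
  have Jv: "J *v v = v"
    using v(2) by (simp add: matrix_vector_mult_diff_rdistrib)
  define w :: "complex^3" where "w = (\<chi> i. complex_of_real (v $ i))"
  have "w \<noteq> 0"
    using v(1) by (auto simp: w_def vec_eq_iff)
  moreover have "map_matrix complex_of_real J *v w = 1 *s w"
  proof -
    have "(\<Sum>j\<in>UNIV. complex_of_real (J $ i $ j) * complex_of_real (v $ j)) = complex_of_real (v $ i)"
      for i
    proof -
      have "(\<Sum>j\<in>UNIV. J $ i $ j * v $ j) = v $ i"
        using arg_cong[OF Jv, of "\<lambda>u. u $ i"] by (simp add: matrix_vector_mult_def)
      then show ?thesis
        by (metis (no_types, lifting) of_real_mult of_real_sum sum.cong)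
    qed
    then show ?thesis
      by (simp add: vec_eq_iff matrix_vector_mult_def w_def)
  qed
  ultimately have "complex_eigenvalue J 1"
    unfolding complex_eigenvalue_def by blast
  from ev[OF this] show False by simp
qed

end

theory Submission
  imports Defs "HOL-Real_Asymp.Real_Asymp"
begin

text \<open>
  At the equilibrium both Jacobians are the same matrix: the $T_{LNB}$ Jacobian is the
  $T_{ANB}$ Jacobian with $l = 2/3$.  Its characteristic polynomial $p$ depends only on $l$ and
  $m = c k$, and $-48\,p(-1) = 192 - 102\,l - m\,(68 - 33\,l)$.  If this is not positive,
  the intermediate value theorem gives a real root in $(-\infty, -1]$.  If it is
  positive, the Taylor coefficients of $p$ at $1$ and of $-p(-x)$ at $1$ are positive, which excludes
  real roots outside the disk, and for a nonreal root $z$ with conjugate $\bar z$ and third root $r$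
  the positive quantity $1 - a_1 + a_0 a_2 - a_0^2$ equals $(1 - |z|^2)\,|1 - r z|^2$.
\<close>

section \<open>Eigenvalues and characteristic polynomials\<close>

lemma complex_eigenvalue_iff_det:
  "complex_eigenvalue A z \<longleftrightarrow> det (map_matrix complex_of_real A - mat z) = 0"
proof -
  define B where "B = map_matrix complex_of_real A - mat z"
  have mat: "mat z *v v = z *s v" for v :: "complex^'n"
    by (simp add: vec_eq_iff matrix_vector_mult_def mat_def if_distrib [of "\<lambda>x. x * _"] cong: if_cong)
  have "complex_eigenvalue A z \<longleftrightarrow> (\<exists>v. v \<noteq> 0 \<and> B *v v = 0)"
    by (simp add: complex_eigenvalue_def B_def matrix_vector_mult_diff_rdistrib mat)
  also have "\<dots> \<longleftrightarrow> \<not> invertible B"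
    by (metis invertible_left_inverse matrix_left_invertible_ker)
  also have "\<dots> \<longleftrightarrow> det B = 0"
    by (simp add: invertible_det_nz)
  finally show ?thesis
    by (simp add: B_def)
qed

text \<open>By uniqueness of the derivative, any matrix \<open>J\<close> representing it is the
  Jacobian, so the criterion can be tested on an explicit matrix.\<close>

lemma locally_stable_iff:
  assumes "f p = p" and "(f has_derivative (\<lambda>h. J *v h)) (at p)"
  shows "locally_stable f p \<longleftrightarrow>
    (\<forall>z. det (map_matrix complex_of_real J - mat z) = 0 \<longrightarrow> cmod z < 1)"
proof -
  have "jacobian f (at p) = J"
    by (simp add: jacobian_def flip: frechet_derivative_at [OF assms(2)])
  moreover have "f differentiable (at p)"
    using assms(2) by (auto simp: differentiable_def)
  ultimately show ?thesis
    using assms(1) by (simp add: locally_stable_def complex_eigenvalue_iff_det)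
qed

lemma has_derivative_vector_3:
  fixes f1 f2 f3 :: "'a::real_normed_vector \<Rightarrow> real"
  assumes "(f1 has_derivative g1) F" "(f2 has_derivative g2) F" "(f3 has_derivative g3) F"
  shows "((\<lambda>x. vector [f1 x, f2 x, f3 x] :: real^3) has_derivative
    (\<lambda>h. vector [g1 h, g2 h, g3 h])) F"
proof -
  have vec: "(vector [a, b, c] :: real^3) = a *\<^sub>R axis 1 1 + b *\<^sub>R axis 2 1 + c *\<^sub>R axis 3 1" for a b c
    by (simp add: vec_eq_iff forall_3 axis_def)
  show ?thesis
    unfolding vec by (intro has_derivative_add has_derivative_scaleR_left assms)
qed

section \<open>Real cubics\<close>

lemma cubic_nonreal_root_norm_less_1:
  fixes a0 a1 a2 :: real
  assumes root: "z ^ 3 + of_real a2 * z\<^sup>2 + of_real a1 * z + of_real a0 = 0"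
    and nonreal: "Im z \<noteq> 0"
    and pos: "1 - a1 + a0 * a2 - a0\<^sup>2 > 0"
  shows "cmod z < 1"
proof -
  obtain x y where z: "z = Complex x y"
    by (cases z)
  have y: "y \<noteq> 0"
    using nonreal by (simp add: z)
  have re: "x ^ 3 - 3 * x * y\<^sup>2 + a2 * (x\<^sup>2 - y\<^sup>2) + a1 * x + a0 = 0"
    and "y * (3 * x\<^sup>2 - y\<^sup>2 + 2 * a2 * x + a1) = 0"
    using root by (simp_all add: z complex_eq_iff power3_eq_cube power2_eq_square algebra_simps)
  with y have im: "3 * x\<^sup>2 - y\<^sup>2 + 2 * a2 * x + a1 = 0"
    by simp
  \<comment> \<open>By Vieta, \<open>r\<close> is the third root, since \<open>z\<close> and its
    conjugate sum to \<open>2 * x\<close>; \<open>w\<close> is the squared modulus of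
    \<open>z\<close>.\<close>
  define r where "r = - (a2 + 2 * x)"
  define w where "w = x\<^sup>2 + y\<^sup>2"
  have a2: "a2 = - (r + 2 * x)"
    by (simp add: r_def)
  have a1: "a1 = w + 2 * r * x"
    using im by (simp add: a2 w_def algebra_simps power2_eq_square)
  have a0: "a0 = - (r * w)"
    using re by (simp add: a2 a1 w_def algebra_simps power2_eq_square power3_eq_cube)
  have "1 - a1 + a0 * a2 - a0\<^sup>2 = (1 - w) * ((1 - r * x)\<^sup>2 + (r * y)\<^sup>2)"
    by (simp add: a0 a1 a2 w_def algebra_simps power2_eq_square)
  with pos have "w < 1"
    by (smt (verit) zero_le_power2 mult_nonpos_nonneg)
  then show ?thesis
    by (simp add: z w_def cmod_def)
qed

lemma cubic_real_root_le:
  fixes a0 a1 a2 b :: real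
  assumes "b ^ 3 + a2 * b\<^sup>2 + a1 * b + a0 \<ge> 0"
  obtains r where "r \<le> b" "r ^ 3 + a2 * r\<^sup>2 + a1 * r + a0 = 0"
proof -
  define p where "p = (\<lambda>x. x ^ 3 + a2 * x\<^sup>2 + a1 * x + a0)"
  have "LIM x at_bot. p x :> at_bot"
    unfolding p_def by real_asymp
  then have "eventually (\<lambda>x. p x \<le> 0) at_bot"
    by (simp add: filterlim_at_bot)
  then obtain B where B: "\<And>x. x \<le> B \<Longrightarrow> p x \<le> 0"
    by (auto simp: eventually_at_bot_linorder)
  have "\<exists>x. min b B \<le> x \<and> x \<le> b \<and> p x = 0"
  proof (rule IVT')
    show "p (min b B) \<le> 0" "min b B \<le> b"
      using B by simp_all
    show "0 \<le> p b"
      using assms by (simp add: p_def)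
    show "continuous_on {min b B..b} p"
      unfolding p_def by (intro continuous_intros)
  qed
  with that show thesis
    by (auto simp: p_def)
qed

section \<open>The common Jacobian\<close>

text \<open>The rows linearise a best reply taken with weight \<open>l\<close>, a full best reply
  and the gradient rule; \<open>m\<close> stands for \<open>c * k\<close>.\<close>

definition jac :: "real \<Rightarrow> real \<Rightarrow> real^3^3" where
  "jac l m = vector [vector [1 - l, - l / 4, - l / 4],
                     vector [- 1 / 4, 0, - 1 / 4],
                     vector [- m / 6, - m / 6, 1 - 2 * m / 3]]"

context
  fixes l m a0 a1 a2 :: real
  defines "a2 \<equiv> l - 2 + 2 * m / 3"
    and "a1 \<equiv> - l / 16 + (1 - l) * (1 - 2 * m / 3) - l * m / 24 - m / 24"
    and "a0 \<equiv> m / 24 - l * m / 16 + l / 16"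
begin

text \<open>\<open>a2\<close>, \<open>a1\<close>, \<open>a0\<close> are minus the trace, the sum of
  the principal 2x2 minors and minus the determinant. The outer sign comes from the odd
  dimension.\<close>

lemma det_jac:
  "det (map_matrix complex_of_real (jac l m) - mat z)
    = - (z ^ 3 + of_real a2 * z\<^sup>2 + of_real a1 * z + of_real a0)"
  by (simp add: det_3 map_matrix_def jac_def mat_def a0_def a1_def a2_def field_simps
      power2_eq_square power3_eq_cube)

text \<open>For positive \<open>l\<close> and \<open>m\<close> every coefficient is positive, so
  there is no real root at or above 1. At \<open>l = 0\<close> the constant term vanishes and 1 is a
  root.\<close>

lemma jac_poly_at_1_plus:
  "(1 + t) ^ 3 + a2 * (1 + t)\<^sup>2 + a1 * (1 + t) + a0
    = t ^ 3 + (1 + l + 2 * m / 3) * t\<^sup>2 + (15 * l / 16 + 5 * m / 8 + 5 * l * m / 8) * t + 9 * l * m / 16"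
  by (simp add: a0_def a1_def a2_def field_simps power2_eq_square power3_eq_cube)

text \<open>Reflection turns roots at or below -1 into roots \<open>t \<ge> 0\<close>. The constant
  term carries the stability bound.\<close>

lemma jac_poly_at_minus_1_minus:
  "- ((- 1 - t) ^ 3 + a2 * (- 1 - t)\<^sup>2 + a1 * (- 1 - t) + a0)
    = t ^ 3 + (5 - l - 2 * m / 3) * t\<^sup>2 + (384 - 147 * l - m * (98 - 30 * l)) / 48 * t
      + (192 - 102 * l - m * (68 - 33 * l)) / 48"
  by (simp add: a0_def a1_def a2_def field_simps power2_eq_square power3_eq_cube)

lemma jac_spectrum:
  assumes l: "0 < l" "l \<le> 1" and m: "0 < m"
  shows "(\<forall>z. det (map_matrix complex_of_real (jac l m) - mat z) = 0 \<longrightarrow> cmod z < 1) \<longleftrightarrow>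
    m < (192 - 102 * l) / (68 - 33 * l)"
    (is "?stable \<longleftrightarrow> _")
proof -
  have "m < (192 - 102 * l) / (68 - 33 * l) \<longleftrightarrow> m * (68 - 33 * l) < 192 - 102 * l"
    using l by (simp add: pos_less_divide_eq)
  also have "\<dots> \<longleftrightarrow> ?stable"
  proof
    assume bound: "m * (68 - 33 * l) < 192 - 102 * l"
    \<comment> \<open>At \<open>m = 3\<close> the left side of \<open>bound\<close> is
      \<open>204 - 99 * l\<close>, which already exceeds the right side.\<close>
    have m3: "m < 3"
    proof (rule ccontr)
      assume "\<not> m < 3"
      then have "3 * (68 - 33 * l) \<le> m * (68 - 33 * l)"
        using l by (intro mult_right_mono) auto
      with bound l show False by simp
    qed
    have lm: "0 < l * m" "l * m \<le> m"
      using l m by (simp_all add: mult_left_le_one_le)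
    \<comment> \<open>This expression is \<open>48 * a0\<close>.\<close>
    have "0 \<le> 2 * (m - l * m) + l * (3 - m)"
      using l m3 lm by simp
    then have a0: "0 \<le> a0"
      by (simp add: a0_def algebra_simps)
    \<comment> \<open>The target \<open>pos\<close> is split as
      \<open>(1 - a1 - 2 * a0) + a0 * (a2 - a0 + 2)\<close>, a positive term plus a nonnegative
      one.\<close>
    have "a0 \<le> m / 24 + l / 16"
      using lm by (simp add: a0_def)
    then have "- 2 \<le> a2 - a0"
      using l m by (simp add: a2_def)
    then have "a0 * (- 2) \<le> a0 * (a2 - a0)"
      using a0 by (rule mult_left_mono)
    moreover have "1 - a1 - 2 * a0 = 15 / 16 * l + 5 / 8 * m - l * m / 2"
      by (simp add: a1_def a0_def field_simps)
    then have "0 < 1 - a1 - 2 * a0"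
      using l m lm by linarith
    ultimately have pos: "1 - a1 + a0 * a2 - a0\<^sup>2 > 0"
      by (simp add: algebra_simps power2_eq_square)
    have linear_pos: "0 < 384 - 147 * l - m * (98 - 30 * l)"
    proof -
      \<comment> \<open>$(384 - 147\,l)(68 - 33\,l) - (192 - 102\,l)(98 - 30\,l)$ expanded at $l = 1$\<close>
      have "0 < 2175 + 3330 * (1 - l) + 1791 * (1 - l)\<^sup>2"
        using l by (simp add: add_pos_nonneg)
      \<comment> \<open>Multiplying \<open>bound\<close> by a positive factor eliminates
        \<open>m\<close> from the target, leaving the quadratic in \<open>l\<close> above.\<close>
      moreover have "m * (68 - 33 * l) * (98 - 30 * l) \<le> (192 - 102 * l) * (98 - 30 * l)"
        using bound l by (intro mult_right_mono) auto
      ultimately have "0 < (384 - 147 * l - m * (98 - 30 * l)) * (68 - 33 * l)"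
        by (simp add: algebra_simps power2_eq_square)
      then show ?thesis
        using l by (simp add: zero_less_mult_iff)
    qed
    show ?stable
    proof (intro allI impI)
      fix z
      assume "det (map_matrix complex_of_real (jac l m) - mat z) = 0"
      then have root: "z ^ 3 + of_real a2 * z\<^sup>2 + of_real a1 * z + of_real a0 = 0"
        by (simp only: det_jac neg_equal_0_iff_equal)
      show "cmod z < 1"
      proof (cases "Im z = 0")
        case False
        with cubic_nonreal_root_norm_less_1 [OF root] pos show ?thesis
          by simp
      next
        case True
        then obtain x where z: "z = of_real x"
          by (metis complex_is_Real_iff Reals_cases)
        have "of_real (x ^ 3 + a2 * x\<^sup>2 + a1 * x + a0) = (0 :: complex)"
          using root by (simp add: z)
        then have px: "x ^ 3 + a2 * x\<^sup>2 + a1 * x + a0 = 0"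
          by (simp only: of_real_eq_0_iff)
        have "x < 1"
        proof (rule ccontr)
          assume "\<not> x < 1"
          then have "0 < (x - 1) ^ 3 + (1 + l + 2 * m / 3) * (x - 1)\<^sup>2
              + (15 * l / 16 + 5 * m / 8 + 5 * l * m / 8) * (x - 1) + 9 * l * m / 16"
            using l m by (intro add_nonneg_pos add_nonneg_nonneg mult_nonneg_nonneg) auto
          with jac_poly_at_1_plus [of "x - 1"] px show False
            by simp
        qed
        moreover have "- 1 < x"
        proof (rule ccontr)
          assume "\<not> - 1 < x"
          then have "0 < (- 1 - x) ^ 3 + (5 - l - 2 * m / 3) * (- 1 - x)\<^sup>2
              + (384 - 147 * l - m * (98 - 30 * l)) / 48 * (- 1 - x)
              + (192 - 102 * l - m * (68 - 33 * l)) / 48"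
            using l m3 linear_pos bound
            by (intro add_nonneg_pos add_nonneg_nonneg mult_nonneg_nonneg) auto
          with jac_poly_at_minus_1_minus [of "- 1 - x"] px show False
            by simp
        qed
        ultimately show ?thesis
          by (simp add: z)
      qed
    qed
  next
    assume stable: ?stable
    show "m * (68 - 33 * l) < 192 - 102 * l"
    proof (rule ccontr)
      assume "\<not> m * (68 - 33 * l) < 192 - 102 * l"
      \<comment> \<open>At \<open>t = 0\<close> the identity shows that failure of the bound makes
        the polynomial nonnegative at -1.\<close>
      with jac_poly_at_minus_1_minus [of 0]
      have "(- 1) ^ 3 + a2 * (- 1)\<^sup>2 + a1 * (- 1) + a0 \<ge> 0"
        by simp
      then obtain r where r: "r \<le> - 1" "r ^ 3 + a2 * r\<^sup>2 + a1 * r + a0 = 0"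
        by (rule cubic_real_root_le)
      have "det (map_matrix complex_of_real (jac l m) - mat (of_real r))
          = - of_real (r ^ 3 + a2 * r\<^sup>2 + a1 * r + a0)"
        unfolding det_jac by simp
      with r(2) have "det (map_matrix complex_of_real (jac l m) - mat (of_real r)) = 0"
        by simp
      with stable have "cmod (of_real r) < 1"
        by blast
      with r(1) show False
        by simp
    qed
  qed
  finally show ?thesis
    by blast
qed

end

section \<open>Linearisation of the two models\<close>

context
  fixes c :: real
  assumes c: "c > 0"
begin

lemma E2_equal_costs: "E2 c c c = vector [2 / (9 * c), 2 / (9 * c), 2 / (9 * c)]"
  using c by (simp add: E2_def vec_eq_iff forall_3 power2_eq_square field_simps)

lemma sqrt_equal_costs: "sqrt (4 / (9 * c) / c) = 2 / (3 * c)"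
  using c by (intro real_sqrt_unique) (auto simp: power2_eq_square field_simps)

text \<open>At the total \<open>4 / (9 * c)\<close> the square root term has slope 3/4, hence the
  net slope -1/4. The indices \<open>i\<close>, \<open>j\<close> cover both the first and the second
  player.\<close>

lemma best_reply_has_derivative:
  "((\<lambda>s :: real^3. sqrt ((s $ i + s $ j) / c) - (s $ i + s $ j))
    has_derivative (\<lambda>h. - ((h $ i + h $ j) / 4))) (at (E2 c c c))"
proof -
  let ?u = "\<lambda>s :: real^3. s $ i + s $ j"
  have u: "(?u has_derivative ?u) (at (E2 c c c))"
    by (intro has_derivative_add bounded_linear_imp_has_derivative bounded_linear_vec_nth)
  have uE2: "?u (E2 c c c) = 4 / (9 * c)"
    using exhaust_3 [of i] exhaust_3 [of j] by (auto simp: E2_equal_costs)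
  have "((\<lambda>t. sqrt (t / c) - t) has_real_derivative
      1 / c * (inverse (sqrt (4 / (9 * c) / c)) / 2) - 1) (at (4 / (9 * c)))"
    using c by (auto intro!: derivative_eq_intros)
  also have "1 / c * (inverse (sqrt (4 / (9 * c) / c)) / 2) - 1 = - 1 / 4"
    unfolding sqrt_equal_costs using c by simp
  finally have "((\<lambda>t. sqrt (t / c) - t) has_derivative (\<lambda>t. - 1 / 4 * t)) (at (?u (E2 c c c)))"
    unfolding uE2 has_field_derivative_def .
  from has_derivative_compose [OF u this] show ?thesis
    by simp
qed

text \<open>The bracket vanishes at the equilibrium, so only \<open>k * s $ 3\<close> times its
  gradient is added to the identity part.\<close>

lemma gradient_has_derivative:
  "((\<lambda>s :: real^3. s $ 3 + k * s $ 3 * ((s $ 1 + s $ 2) / (s $ 1 + s $ 2 + s $ 3)\<^sup>2 - c))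
    has_derivative (\<lambda>h. - (c * k) / 6 * h $ 1 - (c * k) / 6 * h $ 2 + (1 - 2 * (c * k) / 3) * h $ 3))
    (at (E2 c c c))"
  using c unfolding E2_equal_costs
  by (auto intro!: derivative_eq_intros bounded_linear.has_derivative [OF bounded_linear_vec_nth]
        simp: field_simps power2_eq_square)

lemma jac_mult:
  "jac l m *v h = vector [(1 - l) * h $ 1 + l * (- ((h $ 2 + h $ 3) / 4)), - ((h $ 1 + h $ 3) / 4),
    - m / 6 * h $ 1 - m / 6 * h $ 2 + (1 - 2 * m / 3) * h $ 3]"
  by (simp add: vec_eq_iff forall_3 matrix_vector_mult_def sum_3 jac_def field_simps)

lemma T_ANB_linearisation:
  "T_ANB c c c k l (E2 c c c) = E2 c c c"
  "(T_ANB c c c k l has_derivative (\<lambda>h. jac l (c * k) *v h)) (at (E2 c c c))"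
proof -
  show "T_ANB c c c k l (E2 c c c) = E2 c c c"
    using c sqrt_equal_costs unfolding E2_equal_costs T_ANB_def
    by (simp add: vec_eq_iff forall_3 field_simps power2_eq_square)
  \<comment> \<open>The subtracted outputs are grouped into one sum to match
    \<open>best_reply_has_derivative\<close>.\<close>
  have "(T_ANB c c c k l) = (\<lambda>s. vector
      [(1 - l) * s $ 1 + l * (sqrt ((s $ 2 + s $ 3) / c) - (s $ 2 + s $ 3)),
       sqrt ((s $ 1 + s $ 3) / c) - (s $ 1 + s $ 3),
       s $ 3 + k * s $ 3 * ((s $ 1 + s $ 2) / (s $ 1 + s $ 2 + s $ 3)\<^sup>2 - c)])"
    by (simp add: T_ANB_def Let_def fun_eq_iff algebra_simps)
  then show "(T_ANB c c c k l has_derivative (\<lambda>h. jac l (c * k) *v h)) (at (E2 c c c))"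
    unfolding jac_mult
    by (simp only:) (intro has_derivative_vector_3 gradient_has_derivative best_reply_has_derivative
        has_derivative_add has_derivative_mult_right bounded_linear_imp_has_derivative
        bounded_linear_vec_nth)
qed

text \<open>At total output \<open>2 / (3 * c)\<close> the quadratic term has slope 4/3 in each
  variable, so the first row is 1/3, -1/6, -1/6, which is that of \<open>jac\<close> at
  \<open>l = 2 / 3\<close>.\<close>

lemma T_LNB_linearisation:
  "T_LNB c c c k (E2 c c c) = E2 c c c"
  "(T_LNB c c c k has_derivative (\<lambda>h. jac (2 / 3) (c * k) *v h)) (at (E2 c c c))"
proof -
  show "T_LNB c c c k (E2 c c c) = E2 c c c"
    using c sqrt_equal_costs unfolding E2_equal_costs T_LNB_def
    by (simp add: Let_def vec_eq_iff forall_3 field_simps power2_eq_square)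
  have eq: "(T_LNB c c c k) = (\<lambda>s. vector
      [(1/2) * (2 * s $ 1 + s $ 2 + s $ 3 - c * (s $ 1 + s $ 2 + s $ 3)\<^sup>2),
       sqrt ((s $ 1 + s $ 3) / c) - (s $ 1 + s $ 3),
       s $ 3 + k * s $ 3 * ((s $ 1 + s $ 2) / (s $ 1 + s $ 2 + s $ 3)\<^sup>2 - c)])"
    by (simp add: T_LNB_def Let_def fun_eq_iff algebra_simps)
  have "((\<lambda>s :: real^3. (1/2) * (2 * s $ 1 + s $ 2 + s $ 3 - c * (s $ 1 + s $ 2 + s $ 3)\<^sup>2))
      has_derivative (\<lambda>h. (1 - 2 / 3) * h $ 1 + 2 / 3 * (- ((h $ 2 + h $ 3) / 4)))) (at (E2 c c c))"
    using c unfolding E2_equal_costs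
    by (auto intro!: derivative_eq_intros bounded_linear.has_derivative [OF bounded_linear_vec_nth]
        simp: field_simps power2_eq_square)
  then show "(T_LNB c c c k has_derivative (\<lambda>h. jac (2 / 3) (c * k) *v h)) (at (E2 c c c))"
    unfolding jac_mult eq
    by (intro has_derivative_vector_3 gradient_has_derivative best_reply_has_derivative)
qed

end

theorem theorem3:
  fixes c k :: real
  assumes "c > 0" and "k > 0"
  shows "(\<forall>l::real. 0 < l \<and> l \<le> 1 \<longrightarrow>
            (locally_stable (T_ANB c c c k l) (E2 c c c) \<longleftrightarrow>
             c * k < (192 - 102 * l) / (68 - 33 * l)))
       \<and> (locally_stable (T_LNB c c c k) (E2 c c c) \<longleftrightarrow> c * k < 62 / 23)"
proof (intro conjI allI impI)
  have ck: "0 < c * k"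
    using assms by simp
  show "locally_stable (T_ANB c c c k l) (E2 c c c) \<longleftrightarrow> c * k < (192 - 102 * l) / (68 - 33 * l)"
    if "0 < l \<and> l \<le> 1" for l
    using that ck jac_spectrum [of l "c * k"]
    by (simp add: locally_stable_iff [OF T_ANB_linearisation [OF assms(1)]])
  \<comment> \<open>At \<open>l = 2 / 3\<close> the general bound is 124/46 = 62/23.\<close>
  show "locally_stable (T_LNB c c c k) (E2 c c c) \<longleftrightarrow> c * k < 62 / 23"
    using ck jac_spectrum [of "2 / 3" "c * k"]
    by (simp add: locally_stable_iff [OF T_LNB_linearisation [OF assms(1)]])
qed

end
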